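(* Let $(n_k)_{k\ge 0}$ be a strictly increasing sequence of positive integers with $n_0=1$ and let $c$ be a real number such that $$\sup_{k\ge 0}\frac{n_{k+1}}{n_k}\le c<+\infty .$$ Then $\big((n_k)_{k\ge 0},\,2\sin(\pi/(c+1))\big)$ is a Jamison pair.
   Context: Let $\mathbb{T}=\{\lambda\in\mathbb{C}:|\lambda|=1\}$. For a strictly increasing sequence $(n_k)_{k\ge 0}$ of positive integers with $n_0=1$ and a real number $\varepsilon>0$, one says that $((n_k)_{k\ge 0},\varepsilon)$ is a Jamison pair if for every $\lambda\in\mathbb{T}\setminus\{1\}$ one has $\sup_{k\ge 0}|\lambda^{n_k}-1|\ge\varepsilon$. *)

theory Defs
  imports Complex_Main "HOL-Library.Extended_Real"
begin

definition unit_circle :: "complex set" where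
  "unit_circle = {z. cmod z = 1}"

definition admissible_seq :: "(nat \<Rightarrow> nat) \<Rightarrow> bool" where
  "admissible_seq n \<longleftrightarrow> strict_mono n \<and> (\<forall>k. 0 < n k) \<and> n 0 = 1"

(* The standing requirements on the sequence and on eps are part of the predicate.
   The real-valued supremum is a genuine one: on the unit circle the family is bounded by 2. *)
definition jamison_pair :: "(nat \<Rightarrow> nat) \<Rightarrow> real \<Rightarrow> bool" where
  "jamison_pair n eps \<longleftrightarrow>
     admissible_seq n \<and> 0 < eps \<and>
     (\<forall>z \<in> unit_circle - {1}. (SUP k. cmod (z ^ n k - 1)) \<ge> eps)"

end

theory Submission
  imports Defs
begin

text \<open>
  Write \<open>\<lambda> = cis \<theta>\<close> with \<open>0 < \<bar>\<theta>\<bar> \<le> \<pi>\<close> and put \<open>x = \<bar>\<theta>\<bar> / 2\<close>, so that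
  \<open>\<bar>\<lambda>\<^sup>m - 1\<bar> = 2 \<bar>sin (m x)\<bar>\<close>.  Let \<open>a = \<pi> / (c + 1)\<close>.  The constant is chosen so that
  \<open>c a = \<pi> - a\<close>: the band \<open>[a, \<pi> - a]\<close>, on which \<open>sin \<ge> sin a\<close>, is
  exactly as wide, multiplicatively, as the bound \<open>c\<close> on ratios of consecutive terms.
  The numbers \<open>n\<^sub>k x\<close> start in \<open>(0, \<pi>/2]\<close> and tend to infinity, so they have to
  enter the region beyond \<open>a\<close>, and the first one to do so cannot jump over the band.
  Hence some \<open>\<bar>\<lambda>\<^bsup>n\<^sub>k\<^esup> - 1\<bar>\<close> is already at least \<open>2 sin a\<close>.
\<close>

lemma cmod_cis_minus_1: "cmod (cis t - 1) = 2 * \<bar>sin (t / 2)\<bar>"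
proof -
  have "(cmod (cis t - 1))\<^sup>2 = (cos t - 1)\<^sup>2 + (sin t)\<^sup>2"
    by (simp add: cmod_power2)
  also have "\<dots> = 2 - 2 * cos t"
    using sin_cos_squared_add[of t] by (simp add: power2_eq_square algebra_simps)
  also have "\<dots> = (2 * \<bar>sin (t / 2)\<bar>)\<^sup>2"
    using cos_double_sin[of "t / 2"] by (simp add: power_mult_distrib)
  finally show ?thesis
    by (rule power2_eq_imp_eq) simp_all
qed

lemma sin_ge_of_mem_band:
  fixes a y :: real
  assumes "0 \<le> a" "a \<le> y" "y \<le> pi - a"
  shows "sin a \<le> sin y"
proof (cases "y \<le> pi / 2")
  case True
  then show ?thesis
    using assms by (intro sin_monotone_2pi_le) auto
next
  case False
  then have "sin a \<le> sin (pi - y)"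
    using assms by (intro sin_monotone_2pi_le) auto
  then show ?thesis by simp
qed

text \<open>
  A sequence whose ratios are at most \<open>c\<close> cannot jump over \<open>[a, c a]\<close>.  The first term
  must be at most \<open>c a\<close> rather than below \<open>a\<close>, because it may already lie in the band.
\<close>

lemma unbounded_seq_hits_band:
  fixes u :: "nat \<Rightarrow> real"
  assumes start: "u 0 \<le> c * a" and "0 \<le> c"
    and ratio: "\<And>k. u (Suc k) \<le> c * u k"
    and large: "\<exists>k. a \<le> u k"
  obtains k where "a \<le> u k" "u k \<le> c * a"
proof -
  define k where "k = (LEAST k. a \<le> u k)"
  have k: "a \<le> u k"
    unfolding k_def using large by (rule LeastI_ex)
  have "u k \<le> c * a"
  proof (cases k)
    case 0
    then show ?thesis using start by simp
  next
    case (Suc j)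
    then have "u j < a"
      using not_less_Least[of j "\<lambda>k. a \<le> u k"] by (simp add: k_def)
    then have "c * u j \<le> c * a"
      using \<open>0 \<le> c\<close> by (intro mult_left_mono) auto
    then show ?thesis
      using ratio[of j] Suc by simp
  qed
  with k that show ?thesis by blast
qed

lemma strict_mono_mult_unbounded:
  fixes n :: "nat \<Rightarrow> nat" and x :: real
  assumes "strict_mono n" "0 < x"
  shows "\<exists>k. a \<le> real (n k) * x"
proof -
  obtain k where "a < real k * x"
    using reals_Archimedean3[OF \<open>0 < x\<close>] by blast
  also have "\<dots> \<le> real (n k) * x"
    using assms strict_mono_imp_increasing[of n k] by (intro mult_right_mono) auto
  finally show ?thesis by (auto intro: less_imp_le)
qed

theorem proposition1p4:
  fixes n :: "nat \<Rightarrow> nat" and c :: real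
  assumes "strict_mono n"
    and "\<And>k. 0 < n k"
    and "n 0 = 1"
    and "(SUP k. ereal (real (n (Suc k)) / real (n k))) \<le> ereal c"
  shows "jamison_pair n (2 * sin (pi / (c + 1)))"
proof -
  define a where "a = pi / (c + 1)"
  have ratio: "real (n (Suc k)) \<le> c * real (n k)" for k
  proof -
    have "ereal (real (n (Suc k)) / real (n k)) \<le> ereal c"
      using assms(4) by (simp add: SUP_le_iff)
    then show ?thesis
      using assms(2)[of k] by (simp add: divide_le_eq)
  qed
  have "1 < n 1"
    using strict_monoD[OF assms(1), of 0 1] assms(3) by simp
  then have "1 < c"
    using ratio[of 0] assms(3) by simp
  then have a: "0 < a" "a < pi / 2" "c * a = pi - a"
    by (auto simp: a_def field_simps)
  have "2 * sin a \<le> (SUP k. cmod (z ^ n k - 1))" if z: "cmod z = 1" "z \<noteq> 1" for z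
  proof -
    define t where "t = Arg z"
    have "z \<noteq> 0" using z by auto
    then have z_cis: "z = cis t"
      using z(1) cis_Arg[of z] by (simp add: t_def sgn_div_norm)
    have "\<bar>t\<bar> \<le> pi"
      using Arg_bounded[of z] by (auto simp: t_def)
    have "t \<noteq> 0" using z(2) z_cis by auto
    define x where "x = \<bar>t\<bar> / 2"
    have x: "0 < x" "x \<le> pi / 2"
      using \<open>\<bar>t\<bar> \<le> pi\<close> \<open>t \<noteq> 0\<close> by (auto simp: x_def)
    obtain k where k: "a \<le> real (n k) * x" "real (n k) * x \<le> c * a"
    proof (rule unbounded_seq_hits_band[of "\<lambda>k. real (n k) * x" c a])
      show "real (n 0) * x \<le> c * a"
        using x a assms(3) by simp
      show "real (n (Suc k)) * x \<le> c * (real (n k) * x)" for k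
        using mult_right_mono[OF ratio[of k], of x] x by (simp add: mult.assoc)
    qed (use \<open>1 < c\<close> strict_mono_mult_unbounded[OF assms(1) x(1)] in auto)
    have "2 * sin a \<le> 2 * sin (real (n k) * x)"
      using sin_ge_of_mem_band[of a] a k by simp
    also have "\<dots> \<le> 2 * \<bar>sin (real (n k) * t / 2)\<bar>"
      by (cases "0 \<le> t") (simp_all add: x_def abs_if)
    also have "\<dots> = cmod (z ^ n k - 1)"
      by (simp add: z_cis DeMoivre cmod_cis_minus_1)
    also have "\<dots> \<le> (SUP k. cmod (z ^ n k - 1))"
    proof (rule cSUP_upper)
      have "cmod (z ^ m - 1) \<le> 2" for m
        using norm_triangle_ineq4[of "z ^ m" 1] z(1) by (simp add: norm_power)
      then show "bdd_above (range (\<lambda>k. cmod (z ^ n k - 1)))"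
        by (auto intro: bdd_aboveI[of _ 2])
    qed simp
    finally show ?thesis .
  qed
  moreover have "0 < sin a"
    using a by (intro sin_gt_zero) auto
  ultimately show ?thesis
    using assms(1-3)
    by (auto simp: jamison_pair_def admissible_seq_def unit_circle_def a_def)
qed

end
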